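(* Let $n>1$ be an integer. If $n\equiv 1$ or $5\pmod 6$, then $\mathrm{MiD}(P_n)=\frac{n-3}{2}$.
   Context: A Latin square of order $n$ is an $n\times n$ array with entries from $\{1,2,\dots,n\}$ such that each row and each column contains every symbol exactly once. A back diagonal is a set of all cells $(i,j)$ with $i+j\equiv d\pmod n$ for a constant $d$; a forward diagonal is a set of all cells $(i,j)$ with $i-j\equiv d\pmod n$ for a constant $d$. A pandiagonal Latin square of order $n$ is a Latin square of order $n$ such that every forward diagonal and every back diagonal contains each symbol of $\{1,\dots,n\}$ exactly once. Two cells are adjacent if they share an edge horizontally or vertically (no wrap-around). The distance between two adjacent cells containing symbols $u,v$ is $\min\{(u-v)\bmod n,\ (v-u)\bmod n\}$, residues being taken in $\{0,\dots,n-1\}$. The inner distance of a Latin square of order $n\ge2$ is the minimum of the distances over all pairs of adjacent cells. $\mathrm{MiD}(P_n)$ denotes the maximum of the inner distances of all pandiagonal Latin squares of order $n$. *)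

theory Defs
  imports Complex_Main "HOL-Number_Theory.Cong"
begin

text \<open>A square array is a function on cells \<open>(i, j)\<close> (row \<open>i\<close>, column \<open>j\<close>);
  only its values on \<open>cells n\<close> matter.\<close>

definition cells :: "nat \<Rightarrow> (nat \<times> nat) set" where
  "cells n = {1..n} \<times> {1..n}"

definition row :: "nat \<Rightarrow> nat \<Rightarrow> (nat \<times> nat) set" where
  "row n i = {c \<in> cells n. fst c = i}"

definition column :: "nat \<Rightarrow> nat \<Rightarrow> (nat \<times> nat) set" where
  "column n j = {c \<in> cells n. snd c = j}"

definition back_diagonal :: "nat \<Rightarrow> int \<Rightarrow> (nat \<times> nat) set" where
  "back_diagonal n d = {c \<in> cells n. [int (fst c) + int (snd c) = d] (mod int n)}"

definition forward_diagonal :: "nat \<Rightarrow> int \<Rightarrow> (nat \<times> nat) set" where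
  "forward_diagonal n d = {c \<in> cells n. [int (fst c) - int (snd c) = d] (mod int n)}"

definition each_symbol_once :: "nat \<Rightarrow> (nat \<times> nat \<Rightarrow> nat) \<Rightarrow> (nat \<times> nat) set \<Rightarrow> bool" where
  "each_symbol_once n L C \<longleftrightarrow> (\<forall>s\<in>{1..n}. \<exists>!c. c \<in> C \<and> L c = s)"

definition latin_square :: "nat \<Rightarrow> (nat \<times> nat \<Rightarrow> nat) \<Rightarrow> bool" where
  "latin_square n L \<longleftrightarrow>
     (\<forall>c\<in>cells n. L c \<in> {1..n}) \<and>
     (\<forall>i\<in>{1..n}. each_symbol_once n L (row n i)) \<and>
     (\<forall>j\<in>{1..n}. each_symbol_once n L (column n j))"

definition pandiagonal_latin_square :: "nat \<Rightarrow> (nat \<times> nat \<Rightarrow> nat) \<Rightarrow> bool" where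
  "pandiagonal_latin_square n L \<longleftrightarrow>
     latin_square n L \<and>
     (\<forall>d. each_symbol_once n L (forward_diagonal n d)) \<and>
     (\<forall>d. each_symbol_once n L (back_diagonal n d))"

definition adjacent :: "nat \<times> nat \<Rightarrow> nat \<times> nat \<Rightarrow> bool" where
  "adjacent c c' \<longleftrightarrow>
     (fst c = fst c' \<and> (snd c' = snd c + 1 \<or> snd c = snd c' + 1)) \<or>
     (snd c = snd c' \<and> (fst c' = fst c + 1 \<or> fst c = fst c' + 1))"

definition symbol_distance :: "nat \<Rightarrow> nat \<Rightarrow> nat \<Rightarrow> int" where
  "symbol_distance n u v = min ((int u - int v) mod int n) ((int v - int u) mod int n)"

definition inner_distance :: "nat \<Rightarrow> (nat \<times> nat \<Rightarrow> nat) \<Rightarrow> int" where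
  "inner_distance n L =
     Min {symbol_distance n (L c) (L c') | c c'. c \<in> cells n \<and> c' \<in> cells n \<and> adjacent c c'}"

text \<open>For \<open>n \<ge> 2\<close> the set below is finite, since inner distances lie in \<open>{0..<n}\<close>;
  \<open>Max\<close> is only meaningful when, in addition, a pandiagonal Latin square of order \<open>n\<close> exists.\<close>

definition MiD_pandiagonal :: "nat \<Rightarrow> int" where
  "MiD_pandiagonal n = Max {inner_distance n L | L. pandiagonal_latin_square n L}"

end

theory Submission
  imports Defs
begin

text \<open>
  Write \<open>n = 2 * m + 1\<close>, so that the claim is \<open>MiD_pandiagonal n = m - 1\<close>.

  Upper bound. Distances never exceed \<open>m\<close>, and a pair of symbols at distance \<open>m\<close> differs by
  \<open>\<plusminus>m\<close>, that is, by \<open>\<plusminus>1/2\<close> modulo \<open>n\<close>. If all adjacent cells were at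
  distance \<open>m\<close>, then a \<open>2 \<times> 2\<close> block of cells would already be contradictory. Let \<open>x\<close> be
  its top left symbol and \<open>x + e\<close> the one to the right of it, with \<open>2 * e = \<plusminus>1\<close>. The
  symbol below \<open>x\<close> is \<open>x \<plusminus> e\<close>, and it must be \<open>x - e\<close> because of the back diagonal.
  The remaining symbol differs from \<open>x\<close> because of the forward diagonal, so its two neighbours
  force it to be both \<open>x + 2 * e\<close> and \<open>x - 2 * e\<close>. Hence \<open>4 * e = 0\<close>, and doubling
  shows that \<open>n\<close> divides 4, which is impossible for odd \<open>n > 1\<close>.

  Lower bound. The array \<open>a * i + b * j\<close> modulo \<open>n\<close> is a pandiagonal Latin square as soon as
  \<open>a\<close>, \<open>b\<close>, \<open>a + b\<close> and \<open>a - b\<close> are units modulo \<open>n\<close>. The choice \<open>a = m\<close>,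
  \<open>b = m - 1\<close> makes all adjacent distances \<open>m\<close> or \<open>m - 1\<close>; doubling gives
  \<open>2 * a = -1\<close>, \<open>2 * b = -3\<close>, \<open>a + b = -2\<close>, \<open>a - b = 1\<close> modulo \<open>n\<close>, and these are
  units exactly because \<open>n\<close> is prime to 6.
\<close>

section \<open>Symbol distance and inner distance\<close>

lemma symbol_distance_bounds:
  assumes "n > 0"
  shows "0 \<le> symbol_distance n u v" "symbol_distance n u v < int n"
  using assms by (auto simp: symbol_distance_def min_def)

lemma symbol_distance_commute: "symbol_distance n u v = symbol_distance n v u"
  by (simp add: symbol_distance_def min.commute)

lemma symbol_distance_eq:
  assumes "[int u - int v = k] (mod int n)" and "0 \<le> k" and "2 * k \<le> int n" and "n > 0"
  shows "symbol_distance n u v = k"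
proof -
  have 1: "(int u - int v) mod int n = k"
    using assms by (simp add: cong_def)
  have "[int v - int u = - k] (mod int n)"
    using assms(1) cong_minus_minus_iff[of "int u - int v" k "int n"] by simp
  hence 2: "(int v - int u) mod int n = (- k) mod int n"
    by (simp add: cong_def)
  have "k \<le> (- k) mod int n \<or> k = 0"
    using assms by (auto simp: zmod_zminus1_eq_if)
  thus ?thesis
    using 1 2 assms by (auto simp: symbol_distance_def min_def)
qed

text \<open>The two residues whose minimum is the distance add up to \<open>n\<close>, so a distance of at least
  \<open>(n - 1) / 2\<close> leaves only the two residues next to \<open>n / 2\<close>. Twice the difference is then
  \<open>\<plusminus>1\<close> modulo \<open>n\<close>.\<close>

lemma large_symbol_distance:
  assumes "n > 1" and "odd n" and "int n \<le> 2 * symbol_distance n u v + 1"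
  obtains e :: int where "e = 1 \<or> e = - 1" and "[2 * (int v - int u) = e] (mod int n)"
proof -
  define r where "r = (int v - int u) mod int n"
  have r: "0 \<le> r" "r < int n"
    using assms by (auto simp: r_def)
  have "(int u - int v) mod int n = (if r = 0 then 0 else int n - r)"
    using zmod_zminus1_eq_if[of "int v - int u" "int n"] by (simp add: r_def)
  hence "symbol_distance n u v = (if r = 0 then 0 else min (int n - r) r)"
    by (auto simp: symbol_distance_def r_def[symmetric])
  hence "2 * r = int n \<or> 2 * r = int n - 1 \<or> 2 * r = int n + 1"
    using assms(1,3) r by (auto split: if_splits simp: min_def)
  moreover have "2 * r \<noteq> int n"
    using assms(2) by presburger
  ultimately have "2 * r - int n = 1 \<or> 2 * r - int n = - 1"
    by auto
  moreover have "[2 * (int v - int u) = 2 * r - int n] (mod int n)"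
    by (simp add: r_def cong_def mod_mult_right_eq)
  ultimately show thesis
    using that by blast
qed

lemma finite_adjacent_distances:
  assumes "n > 0"
  shows "finite {symbol_distance n (L c) (L c') | c c'.
           c \<in> cells n \<and> c' \<in> cells n \<and> adjacent c c'}"
  by (rule finite_subset[of _ "{0..<int n}"])
    (auto simp: symbol_distance_bounds[OF assms])

lemma adjacent_distances_nonempty:
  assumes "n > 1"
  shows "{symbol_distance n (L c) (L c') | c c'.
           c \<in> cells n \<and> c' \<in> cells n \<and> adjacent c c'} \<noteq> {}"
proof -
  have "(1, 1) \<in> cells n" "(1, 2) \<in> cells n" "adjacent (1, 1) (1, 2)"
    using assms by (auto simp: cells_def adjacent_def)
  thus ?thesis
    by blast
qed

lemma inner_distance_le:
  assumes "n > 1" and "c \<in> cells n" and "c' \<in> cells n" and "adjacent c c'"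
  shows "inner_distance n L \<le> symbol_distance n (L c) (L c')"
  unfolding inner_distance_def
  by (rule Min_le[OF finite_adjacent_distances]) (use assms in \<open>simp, blast\<close>)

lemma inner_distance_attained:
  assumes "n > 1"
  obtains c c' where "c \<in> cells n" and "c' \<in> cells n" and "adjacent c c'"
    and "inner_distance n L = symbol_distance n (L c) (L c')"
proof -
  have "inner_distance n L \<in> {symbol_distance n (L c) (L c') | c c'.
      c \<in> cells n \<and> c' \<in> cells n \<and> adjacent c c'}"
    unfolding inner_distance_def
    using assms by (intro Min_in finite_adjacent_distances adjacent_distances_nonempty) auto
  thus thesis
    using that by blast
qed

section \<open>The upper bound\<close>

lemma each_symbol_once_cong_imp_eq:
  assumes "latin_square n L" and "each_symbol_once n L C" and "c \<in> C" and "c' \<in> C"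
    and "C \<subseteq> cells n" and "[int (L c) = int (L c')] (mod int n)"
  shows "c = c'"
proof -
  have range: "L c \<in> {1..n}" "L c' \<in> {1..n}"
    using assms by (auto simp: latin_square_def)
  have "int n dvd int (L c) - int (L c')"
    using assms(6) by (simp add: cong_iff_dvd_diff)
  moreover have "\<bar>int (L c) - int (L c')\<bar> < int n"
    using range by auto
  ultimately have "L c = L c'"
    using dvd_imp_le_int[of "int (L c) - int (L c')" "int n"] by fastforce
  thus ?thesis
    using assms range unfolding each_symbol_once_def by metis
qed

text \<open>The contradiction in a \<open>2 \<times> 2\<close> block with rows \<open>x\<close>, \<open>y\<close> and \<open>z\<close>, \<open>w\<close>, whose
  two diagonals carry distinct symbols. Doubling avoids the inverse of 2: it turns the steps
  \<open>\<plusminus>1/2\<close> between neighbours into \<open>\<plusminus>1\<close>.\<close>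

lemma no_block_of_half_steps:
  fixes x y z w a b c d N :: int
  assumes "odd N" and "N > 1"
    and "\<not> [x = w] (mod N)" and "\<not> [y = z] (mod N)"
    and xy: "[2 * (y - x) = a] (mod N)" and "a = 1 \<or> a = - 1"
    and xz: "[2 * (z - x) = b] (mod N)" and "b = 1 \<or> b = - 1"
    and yw: "[2 * (w - y) = c] (mod N)" and "c = 1 \<or> c = - 1"
    and zw: "[2 * (w - z) = d] (mod N)" and "d = 1 \<or> d = - 1"
  shows False
proof -
  have two: "coprime N 2"
    using assms(1) by simp
  have "a \<noteq> b"
  proof
    assume "a = b"
    hence "[2 * (y - x) - 2 * (z - x) = 0] (mod N)"
      using cong_diff[OF xy xz] by simp
    hence "N dvd 2 * (y - z)"
      by (simp add: cong_0_iff algebra_simps)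
    hence "N dvd y - z"
      using two coprime_dvd_mult_right_iff by blast
    thus False
      using assms(4) by (simp add: cong_iff_dvd_diff)
  qed
  have nonzero: "N dvd 2 * (w - x) \<Longrightarrow> False"
    using two coprime_dvd_mult_right_iff[of N 2 "w - x"] assms(3)
    by (auto simp: cong_iff_dvd_diff dvd_diff_commute)
  have via_y: "[2 * (w - x) = a + c] (mod N)"
    using cong_add[OF xy yw] by (simp add: algebra_simps)
  have via_z: "[2 * (w - x) = b + d] (mod N)"
    using cong_add[OF xz zw] by (simp add: algebra_simps)
  have "a + c \<noteq> 0" "b + d \<noteq> 0"
    using via_y via_z nonzero by (auto simp: cong_0_iff)
  hence "(a + c) - (b + d) = 4 \<or> (a + c) - (b + d) = - 4"
    using assms \<open>a \<noteq> b\<close> by auto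
  moreover have "N dvd (a + c) - (b + d)"
    using via_y via_z by (metis cong_iff_dvd_diff cong_sym cong_trans)
  ultimately have "N dvd 2 * 2"
    by auto
  moreover have "coprime N (2 * 2)"
    using two by (simp only: coprime_mult_right_iff)
  ultimately have "N dvd 1"
    using coprime_common_divisor[of N "2 * 2" N] by simp
  thus False
    using assms(2) by simp
qed

lemma inner_distance_pandiagonal_less:
  assumes "n > 1" and "odd n" and pan: "pandiagonal_latin_square n L"
  shows "2 * inner_distance n L + 3 \<le> int n"
proof (rule ccontr)
  assume "\<not> ?thesis"
  hence big: "int n \<le> 2 * inner_distance n L + 1"
    using assms(2) by presburger
  have cell: "(i, j) \<in> cells n" if "i \<in> {1, 2}" "j \<in> {1, 2}" for i j
    using that assms(1) by (auto simp: cells_def)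
  have step: "\<exists>e::int. (e = 1 \<or> e = - 1) \<and> [2 * (int (L c') - int (L c)) = e] (mod int n)"
    if "c \<in> cells n" "c' \<in> cells n" "adjacent c c'" for c c'
  proof -
    have "int n \<le> 2 * symbol_distance n (L c) (L c') + 1"
      using inner_distance_le[OF assms(1) that, of L] big by linarith
    from large_symbol_distance[OF assms(1,2) this] show ?thesis
      by metis
  qed
  have latin: "latin_square n L"
    using pan by (simp add: pandiagonal_latin_square_def)
  have "each_symbol_once n L (forward_diagonal n 0)"
    using pan by (simp add: pandiagonal_latin_square_def)
  from each_symbol_once_cong_imp_eq[OF latin this, of "(1, 1)" "(2, 2)"]
  have forward: "\<not> [int (L (1, 1)) = int (L (2, 2))] (mod int n)"
    using cell by (auto simp: forward_diagonal_def)
  have "each_symbol_once n L (back_diagonal n 3)"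
    using pan by (simp add: pandiagonal_latin_square_def)
  from each_symbol_once_cong_imp_eq[OF latin this, of "(1, 2)" "(2, 1)"]
  have backward: "\<not> [int (L (1, 2)) = int (L (2, 1))] (mod int n)"
    using cell by (auto simp: back_diagonal_def)
  obtain a :: int where a: "a = 1 \<or> a = - 1"
      "[2 * (int (L (1, 2)) - int (L (1, 1))) = a] (mod int n)"
    using step[of "(1, 1)" "(1, 2)"] cell by (auto simp: adjacent_def)
  obtain b :: int where b: "b = 1 \<or> b = - 1"
      "[2 * (int (L (2, 1)) - int (L (1, 1))) = b] (mod int n)"
    using step[of "(1, 1)" "(2, 1)"] cell by (auto simp: adjacent_def)
  obtain c :: int where c: "c = 1 \<or> c = - 1"
      "[2 * (int (L (2, 2)) - int (L (1, 2))) = c] (mod int n)"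
    using step[of "(1, 2)" "(2, 2)"] cell by (auto simp: adjacent_def)
  obtain d :: int where d: "d = 1 \<or> d = - 1"
      "[2 * (int (L (2, 2)) - int (L (2, 1))) = d] (mod int n)"
    using step[of "(2, 1)" "(2, 2)"] cell by (auto simp: adjacent_def)
  show False
    by (rule no_block_of_half_steps[OF _ _ forward backward a(2,1) b(2,1) c(2,1) d(2,1)])
      (use assms in auto)
qed

section \<open>Linear pandiagonal Latin squares\<close>

text \<open>The shift by 1 moves the residues \<open>0, \<dots>, n - 1\<close> to the symbols \<open>1, \<dots>, n\<close>.\<close>

definition linear_square :: "nat \<Rightarrow> int \<Rightarrow> int \<Rightarrow> nat \<times> nat \<Rightarrow> nat" where
  "linear_square n a b c = nat ((a * int (fst c) + b * int (snd c)) mod int n) + 1"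

lemma int_linear_square:
  assumes "n > 0"
  shows "int (linear_square n a b c) = (a * int (fst c) + b * int (snd c)) mod int n + 1"
  using assms by (simp add: linear_square_def)

lemma linear_square_in_range: "n > 0 \<Longrightarrow> linear_square n a b c \<in> {1..n}"
  by (auto simp: linear_square_def Suc_le_eq nat_less_iff)

lemma linear_square_eq_iff:
  assumes "n > 0" and "s \<in> {1..n}"
  shows "linear_square n a b c = s \<longleftrightarrow>
           [a * int (fst c) + b * int (snd c) = int s - 1] (mod int n)"
proof -
  have "(int s - 1) mod int n = int s - 1"
    using assms by auto
  thus ?thesis
    using int_linear_square[OF assms(1), of a b c] by (auto simp: cong_def)
qed

lemma ex1_residue_representative:
  assumes "n > 0"
  shows "\<exists>!t. t \<in> {1..n} \<and> [int t = x] (mod int n)"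
proof (rule ex_ex1I)
  have "[(x - 1) mod int n + 1 = x - 1 + 1] (mod int n)"
    by (intro cong_add) auto
  thus "\<exists>t. t \<in> {1..n} \<and> [int t = x] (mod int n)"
    using assms
    by (intro exI[of _ "nat ((x - 1) mod int n) + 1"]) (auto simp: nat_less_iff Suc_le_eq add.commute)
next
  fix t u
  assume t: "t \<in> {1..n} \<and> [int t = x] (mod int n)" and u: "u \<in> {1..n} \<and> [int u = x] (mod int n)"
  have "[int t - 1 = int u - 1] (mod int n)"
    using t u by (intro cong_diff) (auto intro: cong_trans cong_sym)
  thus "t = u"
    using t u cong_less_imp_eq_int[of "int t - 1" "int n" "int u - 1"] by auto
qed

text \<open>Cramer's rule modulo \<open>n\<close>.\<close>

lemma ex1_cell_linear_system:
  fixes p q a b :: int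
  assumes "n > 0" and "coprime (p * b - q * a) (int n)"
  shows "\<exists>!c. c \<in> cells n \<and> [p * int (fst c) + q * int (snd c) = d] (mod int n) \<and>
           [a * int (fst c) + b * int (snd c) = s] (mod int n)"
proof -
  obtain E where E: "[(p * b - q * a) * E = 1] (mod int n)"
    using assms(2) cong_solve_coprime_int by blast
  have solve: "[p * i + q * j = d] (mod int n) \<and> [a * i + b * j = s] (mod int n) \<longleftrightarrow>
      [i = E * (b * d - q * s)] (mod int n) \<and> [j = E * (p * s - a * d)] (mod int n)" for i j
  proof (intro iffI conjI; elim conjE)
    assume d: "[p * i + q * j = d] (mod int n)" and s: "[a * i + b * j = s] (mod int n)"
    have "[E * (b * (p * i + q * j) - q * (a * i + b * j)) = E * (b * d - q * s)] (mod int n)"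
      by (intro cong_mult cong_diff cong_refl d s)
    moreover have "[(p * b - q * a) * E * i = 1 * i] (mod int n)"
      by (intro cong_mult cong_refl E)
    ultimately show "[i = E * (b * d - q * s)] (mod int n)"
      by (simp add: cong_def algebra_simps)
    have "[E * (p * (a * i + b * j) - a * (p * i + q * j)) = E * (p * s - a * d)] (mod int n)"
      by (intro cong_mult cong_diff cong_refl d s)
    moreover have "[(p * b - q * a) * E * j = 1 * j] (mod int n)"
      by (intro cong_mult cong_refl E)
    ultimately show "[j = E * (p * s - a * d)] (mod int n)"
      by (simp add: cong_def algebra_simps)
  next
    assume i: "[i = E * (b * d - q * s)] (mod int n)" and j: "[j = E * (p * s - a * d)] (mod int n)"
    have "[p * i + q * j = p * (E * (b * d - q * s)) + q * (E * (p * s - a * d))] (mod int n)"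
      by (intro cong_add cong_mult cong_refl i j)
    moreover have "[(p * b - q * a) * E * d = 1 * d] (mod int n)"
      by (intro cong_mult cong_refl E)
    ultimately show "[p * i + q * j = d] (mod int n)"
      by (simp add: cong_def algebra_simps)
    have "[a * i + b * j = a * (E * (b * d - q * s)) + b * (E * (p * s - a * d))] (mod int n)"
      by (intro cong_add cong_mult cong_refl i j)
    moreover have "[(p * b - q * a) * E * s = 1 * s] (mod int n)"
      by (intro cong_mult cong_refl E)
    ultimately show "[a * i + b * j = s] (mod int n)"
      by (simp add: cong_def algebra_simps)
  qed
  show ?thesis
    unfolding solve
    using ex1_residue_representative[OF assms(1), of "E * (b * d - q * s)"]
      ex1_residue_representative[OF assms(1), of "E * (p * s - a * d)"]
    by (auto simp: cells_def) blast+
qed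

lemma each_symbol_once_linear_square:
  assumes "n > 0" and "coprime (p * b - q * a) (int n)"
    and C: "C = {c \<in> cells n. [p * int (fst c) + q * int (snd c) = d] (mod int n)}"
  shows "each_symbol_once n (linear_square n a b) C"
  unfolding each_symbol_once_def
proof
  fix s
  assume s: "s \<in> {1..n}"
  show "\<exists>!c. c \<in> C \<and> linear_square n a b c = s"
    using ex1_cell_linear_system[OF assms(1,2), of d "int s - 1"]
    by (simp add: C linear_square_eq_iff[OF assms(1) s] conj_assoc)
qed

text \<open>Each kind of line is given by a linear congruence; the four conditions are the determinants
  of these congruences paired with \<open>a * i + b * j\<close>.\<close>

lemma pandiagonal_linear_square:
  assumes "n > 0" and "coprime a (int n)" and "coprime b (int n)"
    and "coprime (a + b) (int n)" and "coprime (a - b) (int n)"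
  shows "pandiagonal_latin_square n (linear_square n a b)"
proof -
  have cong_eq: "[int t = int u] (mod int n) \<longleftrightarrow> t = u" if "t \<in> {1..n}" "u \<in> {1..n}" for t u
    using ex1_residue_representative[OF assms(1), of "int u"] that by (metis cong_refl)
  have "each_symbol_once n (linear_square n a b) (row n i)" if "i \<in> {1..n}" for i
    by (rule each_symbol_once_linear_square[where p = 1 and q = 0 and d = "int i"])
      (use assms that cong_eq in \<open>auto simp: row_def cells_def\<close>)
  moreover have "each_symbol_once n (linear_square n a b) (column n j)" if "j \<in> {1..n}" for j
    by (rule each_symbol_once_linear_square[where p = 0 and q = 1 and d = "int j"])
      (use assms that cong_eq in \<open>auto simp: column_def cells_def\<close>)
  moreover have "each_symbol_once n (linear_square n a b) (forward_diagonal n d)" for d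
    by (rule each_symbol_once_linear_square[where p = 1 and q = "- 1" and d = d])
      (use assms in \<open>auto simp: forward_diagonal_def add.commute\<close>)
  moreover have "each_symbol_once n (linear_square n a b) (back_diagonal n d)" for d
    by (rule each_symbol_once_linear_square[where p = 1 and q = 1 and d = d])
      (use assms coprime_minus_left_iff[of "a - b" "int n"] in \<open>auto simp: back_diagonal_def\<close>)
  ultimately show ?thesis
    using linear_square_in_range[OF assms(1)]
    by (auto simp: pandiagonal_latin_square_def latin_square_def)
qed

lemma symbol_distance_linear_square:
  assumes "n > 0" and "adjacent c c'"
    and "0 \<le> a" and "2 * a \<le> int n" and "0 \<le> b" and "2 * b \<le> int n"
  shows "symbol_distance n (linear_square n a b c) (linear_square n a b c') \<in> {a, b}"
proof -
  let ?L = "linear_square n a b"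
  have diff: "[int (?L c) - int (?L c') =
      a * (int (fst c) - int (fst c')) + b * (int (snd c) - int (snd c'))] (mod int n)" for c c'
    by (simp add: int_linear_square[OF assms(1)] cong_def mod_diff_eq algebra_simps)
  have "\<exists>k\<in>{a, b}. [int (?L c) - int (?L c') = k] (mod int n) \<or>
      [int (?L c') - int (?L c) = k] (mod int n)"
    using assms(2) diff[of c c'] diff[of c' c] by (auto simp: adjacent_def)
  thus ?thesis
    using symbol_distance_eq[of "?L c" "?L c'" _ n] symbol_distance_eq[of "?L c'" "?L c" _ n]
      symbol_distance_commute[of n "?L c" "?L c'"] assms by auto
qed

section \<open>The maximum\<close>

text \<open>A common divisor of \<open>k\<close> and \<open>n\<close> divides whatever \<open>2 * k\<close> is congruent to modulo
  \<open>n\<close>. With \<open>n = 2 * m + 1\<close>, doubling turns the coefficients \<open>m\<close>, \<open>m - 1\<close> and their sum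
  into \<open>-1\<close>, \<open>-3\<close> and \<open>-4\<close>, which are prime to \<open>n\<close>.\<close>

lemma pandiagonal_square_with_large_inner_distance:
  assumes "n > 1" and "odd n" and "\<not> 3 dvd n"
  obtains L where "pandiagonal_latin_square n L" and "int n \<le> 2 * inner_distance n L + 3"
proof -
  define m where "m = (int n - 1) div 2"
  have n: "int n = 2 * m + 1"
    using assms(2) unfolding m_def by presburger
  have m: "m \<ge> 1"
    using assms(1) n by linarith
  have three: "coprime 3 (int n)"
    using assms(3) prime_imp_coprime[of "3::int" "int n"] by (auto simp: int_dvd_int_iff[of 3 n, simplified])
  have coprime_if: "coprime k (int n)" if "coprime u (int n)" "2 * k + u = int n * v" for k u v :: int
  proof (rule coprimeI)
    fix g
    assume g: "g dvd k" "g dvd int n"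
    hence "g dvd int n * v - 2 * k"
      by (intro dvd_diff) auto
    hence "g dvd u"
      by (simp flip: that(2))
    thus "is_unit g"
      using that(1) g(2) coprime_common_divisor by blast
  qed
  have "coprime 2 (int n)"
    using assms(2) by simp
  hence four: "coprime (2 * 2) (int n)"
    by (simp only: coprime_mult_left_iff)
  let ?L = "linear_square n m (m - 1)"
  have "coprime m (int n)"
    by (rule coprime_if[of 1 _ 1]) (simp_all add: n)
  moreover have "coprime (m - 1) (int n)"
    by (rule coprime_if[OF three, of _ 1]) (simp add: n)
  moreover have "coprime (m + (m - 1)) (int n)"
    by (rule coprime_if[OF four, of _ 2]) (simp add: n)
  moreover have "coprime (m - (m - 1)) (int n)"
    by simp
  ultimately have "pandiagonal_latin_square n ?L"
    using assms(1) by (intro pandiagonal_linear_square) auto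
  moreover have "inner_distance n ?L \<ge> m - 1"
  proof -
    obtain c c' where "adjacent c c'" "inner_distance n ?L = symbol_distance n (?L c) (?L c')"
      using inner_distance_attained[OF assms(1)] by blast
    thus ?thesis
      using symbol_distance_linear_square[of n c c' m "m - 1"] assms(1) m n by auto
  qed
  ultimately show thesis
    using that n by auto
qed

theorem theorem3p1:
  fixes n :: nat
  assumes "n > 1"
    and "[n = 1] (mod 6) \<or> [n = 5] (mod 6)"
  shows "real_of_int (MiD_pandiagonal n) = (real n - 3) / 2"
proof -
  have "n mod 6 = 1 \<or> n mod 6 = 5"
    using assms(2) by (simp add: cong_def)
  hence n: "odd n" "\<not> 3 dvd n"
    by presburger+
  let ?D = "{inner_distance n L | L. pandiagonal_latin_square n L}"
  have "0 \<le> inner_distance n L" for L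
    using inner_distance_attained[OF assms(1), of L] symbol_distance_bounds assms(1)
    by (metis less_trans zero_less_one)
  hence "?D \<subseteq> {0..int n}"
    using inner_distance_pandiagonal_less[OF assms(1) n(1)] by fastforce
  hence fin: "finite ?D"
    using finite_subset by blast
  obtain L where L: "pandiagonal_latin_square n L" "int n \<le> 2 * inner_distance n L + 3"
    using pandiagonal_square_with_large_inner_distance[OF assms(1) n] by blast
  have L_eq: "2 * inner_distance n L + 3 = int n"
    using L inner_distance_pandiagonal_less[OF assms(1) n(1) L(1)] by simp
  have "MiD_pandiagonal n = inner_distance n L"
    unfolding MiD_pandiagonal_def
  proof (rule Max_eqI[OF fin])
    fix d
    assume "d \<in> ?D"
    thus "d \<le> inner_distance n L"
      using inner_distance_pandiagonal_less[OF assms(1) n(1)] L_eq by fastforce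
  qed (use L in auto)
  moreover have "2 * real_of_int (inner_distance n L) + 3 = real n"
    using arg_cong[OF L_eq, of real_of_int] by simp
  ultimately show ?thesis
    by simp
qed

end
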